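(* Let $m>0$, $\omega>0$, and let $s,\ell$ be nonnegative integers with $\ell\ge s$. Let $T$ be the greybody factor (transmission probability) at frequency $\omega$ for the Regge--Wheeler potential of a Schwarzschild black hole of mass $m$, spin $s$ and angular momentum $\ell$ (defined in the context). Then for all frequencies $\omega>0$, $$T\ge\mathrm{sech}^2\left\{\frac{2\ell(\ell+1)+(1-s^2)}{8\omega m}\right\}=\mathrm{sech}^2\left\{\frac{(\ell+1)^2+(\ell^2-s^2)}{8\omega m}\right\}.$$
   Context: Units $G=c=1$. The tortoise coordinate $r_*\in(-\infty,\infty)$ is $r_*=r+2m\ln\frac{r-2m}{2m}$ for $r\in(2m,\infty)$, so that $dr/dr_*=1-2m/r$. The Regge--Wheeler equation is $\frac{d^2\psi}{dr_*^2}+[\omega^2-V(r)]\psi=0$ with Regge--Wheeler potential $V(r)=\left(1-\frac{2m}{r}\right)\left[\frac{\ell(\ell+1)}{r^2}+\frac{2m(1-s^2)}{r^3}\right]$, where $r=r(r_* )$. The greybody factor $T$ is the transmission probability of this one-dimensional scattering problem on $r_*\in\mathbb{R}$: if the solution with $\psi\sim e^{i\omega r_*}$ as $r_*\to-\infty$ behaves as $\psi\sim\alpha e^{i\omega r_*}+\beta e^{-i\omega r_*}$ as $r_*\to+\infty$, then $T=1/|\alpha|^2$. *)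

theory Defs
  imports "HOL-Analysis.Analysis"
begin

definition sech :: "real \<Rightarrow> real" where
  "sech x = 1 / cosh x"

definition tortoise :: "real \<Rightarrow> real \<Rightarrow> real" where
  "tortoise m r = r + 2 * m * ln ((r - 2 * m) / (2 * m))"

text \<open>The areal radius \<open>r(r\<^sub>*)\<close>: for \<open>m > 0\<close> the tortoise coordinate is a bijection from
  \<open>(2m, \<infinity>)\<close> onto the real line.\<close>

definition radius :: "real \<Rightarrow> real \<Rightarrow> real" where
  "radius m = the_inv_into {2 * m<..} (tortoise m)"

definition regge_wheeler_potential :: "real \<Rightarrow> nat \<Rightarrow> nat \<Rightarrow> real \<Rightarrow> real" where
  "regge_wheeler_potential m s l r =
     (1 - 2 * m / r) * (real l * (real l + 1) / r ^ 2 + 2 * m * (1 - (real s) ^ 2) / r ^ 3)"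

text \<open>The equation \<open>\<psi>'' + (\<omega>\<^sup>2 - V) \<psi> = 0\<close> on the whole line, for a potential \<open>V\<close> given as a
  function of the line coordinate.\<close>

definition wave_solution :: "(real \<Rightarrow> real) \<Rightarrow> real \<Rightarrow> (real \<Rightarrow> complex) \<Rightarrow> bool" where
  "wave_solution V \<omega> \<psi> \<longleftrightarrow>
     (\<exists>\<psi>' \<psi>''. \<forall>x.
        (\<psi> has_vector_derivative \<psi>' x) (at x) \<and>
        (\<psi>' has_vector_derivative \<psi>'' x) (at x) \<and>
        \<psi>'' x + of_real (\<omega> ^ 2 - V x) * \<psi> x = 0)"

text \<open>The asymptotic relations are read as ``the difference of both sides tends to zero''. The
  coefficient \<open>\<alpha>\<close> is then determined by \<open>\<psi>\<close>, since the two exponentials are linearly independent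
  modulo functions vanishing at infinity.\<close>

definition scattering_solution ::
  "(real \<Rightarrow> real) \<Rightarrow> real \<Rightarrow> (real \<Rightarrow> complex) \<Rightarrow> complex \<Rightarrow> complex \<Rightarrow> bool" where
  "scattering_solution V \<omega> \<psi> \<alpha> \<beta> \<longleftrightarrow>
     wave_solution V \<omega> \<psi> \<and>
     ((\<lambda>x. \<psi> x - exp (\<i> * of_real (\<omega> * x))) \<longlongrightarrow> 0) at_bot \<and>
     ((\<lambda>x. \<psi> x - (\<alpha> * exp (\<i> * of_real (\<omega> * x)) + \<beta> * exp (- \<i> * of_real (\<omega> * x)))) \<longlongrightarrow> 0) at_top"

definition transmission_probability :: "(real \<Rightarrow> real) \<Rightarrow> real \<Rightarrow> real" where
  "transmission_probability V \<omega> =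
     (THE T. \<exists>\<psi> \<alpha> \<beta>. scattering_solution V \<omega> \<psi> \<alpha> \<beta> \<and> T = 1 / (norm \<alpha>) ^ 2)"

definition greybody_factor :: "real \<Rightarrow> nat \<Rightarrow> nat \<Rightarrow> real \<Rightarrow> real" where
  "greybody_factor m s l \<omega> =
     transmission_probability (\<lambda>x. regge_wheeler_potential m s l (radius m x)) \<omega>"

end

(*
  Write a solution as psi = a exp(i omega x) + b exp(-i omega x) with slowly varying amplitudes whose
  derivatives are V / (2 i omega) times bounded expressions in a and b. Then |a|^2 - |b|^2 = 1 is
  conserved and u = |a|^2 + |b|^2 satisfies u' <= (V / omega) sqrt (u^2 - 1), so that arcosh u grows by
  at most the integral of V / omega, which gives |alpha| <= cosh (integral of V / (2 omega)). For the
  Regge-Wheeler potential dr/dr_* = 1 - 2m/r makes this integral elementary.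
  As the transmission probability is a definite description, the scattering solution must also be
  shown to exist (Picard iteration from -infinity) and to have a unique coefficient alpha (an energy
  estimate shows that a solution vanishing at -infinity is zero).
*)

theory Submission imports Defs begin

section \<open>Antiderivatives and increment bounds on the real line\<close>

lemma vector_antiderivative_exists:
  fixes f :: "real \<Rightarrow> 'a :: euclidean_space"
  assumes "continuous_on UNIV f"
  shows "\<exists>F. \<forall>x. (F has_vector_derivative f x) (at x)"
  using einterval_antiderivative[of "-\<infinity>" "\<infinity>" f] assms
  by (auto simp: continuous_on_eq_continuous_at)

lemma increment_bound:
  fixes f :: "real \<Rightarrow> 'a :: real_normed_vector"
  assumes F: "\<And>x. (F has_vector_derivative f x) (at x)"
    and G: "\<And>x. (G has_real_derivative g x) (at x)"
    and le: "\<And>t. x < t \<Longrightarrow> t < y \<Longrightarrow> norm (f t) \<le> g t" and "x \<le> y"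
  shows "norm (F y - F x) \<le> G y - G x"
proof (cases "x = y")
  case False
  then have "x < y" using \<open>x \<le> y\<close> by simp
  then show ?thesis
  proof (rule differentiable_bound_general)
    show "continuous_on {x..y} F"
      using F has_vector_derivative_continuous continuous_at_imp_continuous_on by blast
    show "continuous_on {x..y} G"
      using G DERIV_isCont continuous_at_imp_continuous_on by blast
  qed (use F G le in \<open>auto simp: has_real_derivative_iff_has_vector_derivative\<close>)
qed auto

text \<open>Sending the lower end of \<open>increment_bound\<close> to -infinity turns a bound on
  derivatives into one on the functions. It replaces estimates of improper integrals from
  -infinity.\<close>

lemma norm_le_if_vanishing_at_bot:
  fixes f :: "real \<Rightarrow> 'a :: real_normed_vector"
  assumes F: "\<And>x. (F has_vector_derivative f x) (at x)" "(F \<longlongrightarrow> 0) at_bot"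
    and G: "\<And>x. (G has_real_derivative g x) (at x)" "(G \<longlongrightarrow> 0) at_bot"
    and le: "\<And>x. norm (f x) \<le> g x"
  shows "norm (F x) \<le> G x"
proof -
  have "((\<lambda>y. norm (F x - F y)) \<longlongrightarrow> norm (F x - 0)) at_bot"
    by (intro tendsto_intros F)
  moreover have "((\<lambda>y. G x - G y) \<longlongrightarrow> G x - 0) at_bot"
    by (intro tendsto_intros G)
  moreover have "eventually (\<lambda>y. norm (F x - F y) \<le> G x - G y) at_bot"
    using eventually_le_at_bot[of x] by eventually_elim (rule increment_bound[OF F(1) G(1) le])
  ultimately have "norm (F x - 0) \<le> G x - 0"
    by (intro tendsto_le) auto
  then show ?thesis by simp
qed

text \<open>\<open>F\<close> inherits the Cauchy property from the convergent \<open>G\<close>, and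
  the target space is complete. The filter is left general so that the same argument serves both
  ends of the line.\<close>

lemma convergent_if_increment_bound:
  fixes F :: "real \<Rightarrow> 'a :: banach" and G :: "real \<Rightarrow> real"
  assumes le: "\<And>x y. x \<le> y \<Longrightarrow> norm (F y - F x) \<le> G y - G x"
    and G: "(G \<longlongrightarrow> l) Fi" and "Fi \<noteq> bot"
  shows "\<exists>L. (F \<longlongrightarrow> L) Fi"
proof -
  have dist: "dist (F x) (F y) \<le> \<bar>G x - G y\<bar>" for x y
    using le[of x y] le[of y x] by (cases "x \<le> y") (auto simp: dist_norm norm_minus_commute)
  have "cauchy_filter (filtermap F Fi)"
    unfolding cauchy_filter_metric_filtermap
  proof (intro allI impI)
    fix e :: real assume "e > 0"
    then have "eventually (\<lambda>x. dist (G x) l < e / 2) Fi"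
      using G tendstoD half_gt_zero by blast
    moreover have "dist (F x) (F y) < e" if "dist (G x) l < e / 2" "dist (G y) l < e / 2" for x y
      using dist[of x y] that by (auto simp: dist_real_def abs_if split: if_splits)
    ultimately show "\<exists>P. eventually P Fi \<and> (\<forall>x y. P x \<and> P y \<longrightarrow> dist (F x) (F y) < e)"
      by blast
  qed
  then have "\<exists>c. filtermap F Fi \<le> nhds c"
    using \<open>Fi \<noteq> bot\<close>
    by (intro cauchy_filter_complete_converges[of _ UNIV]) (auto simp: filtermap_bot_iff complete_UNIV)
  then show ?thesis by (simp add: filterlim_def)
qed

section \<open>Integrable potentials and linear equations solved from -infinity\<close>

text \<open>\<open>W\<close> is the integral of \<open>V\<close> from -infinity and \<open>I\<close>
  is the total integral. Stating integrability through an antiderivative with limits at both ends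
  keeps integration theory out of the estimates: \<open>W\<close> serves as majorant, weight
  exponent and integrating factor.\<close>

locale integrable_potential =
  fixes V W :: "real \<Rightarrow> real" and I :: real
  assumes V_continuous: "continuous_on UNIV V"
    and V_nonneg: "V x \<ge> 0"
    and W_deriv: "(W has_real_derivative V x) (at x)"
    and W_at_bot: "(W \<longlongrightarrow> 0) at_bot"
    and W_at_top: "(W \<longlongrightarrow> I) at_top"
begin

lemma W_mono: "x \<le> y \<Longrightarrow> W x \<le> W y"
  using W_deriv V_nonneg by (intro DERIV_nonneg_imp_nondecreasing[of x y W]) blast+

lemma W_nonneg: "W x \<ge> 0"
  by (rule tendsto_upperbound[OF W_at_bot])
     (auto intro: eventually_mono[OF eventually_le_at_bot[of x]] W_mono)

lemma W_le: "W x \<le> I"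
  by (rule tendsto_lowerbound[OF W_at_top])
     (auto intro: eventually_mono[OF eventually_ge_at_top[of x]] W_mono)

lemma W_isCont: "isCont W x"
  using W_deriv DERIV_isCont by blast

lemma W_continuous [continuous_intros]: "continuous_on A W"
  using W_isCont continuous_at_imp_continuous_on by blast

text \<open>Any antiderivative has increments dominated by those of \<open>K * W\<close>, hence a
  limit at -infinity; subtracting that limit normalises it.\<close>

lemma antiderivative_vanishing_at_bot:
  fixes f :: "real \<Rightarrow> 'a :: euclidean_space"
  assumes cont: "continuous_on UNIV f" and le: "\<And>x. norm (f x) \<le> K * V x"
  shows "\<exists>F. (\<forall>x. (F has_vector_derivative f x) (at x)) \<and> (F \<longlongrightarrow> 0) at_bot"
proof -
  obtain F where F: "\<And>x. (F has_vector_derivative f x) (at x)"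
    using vector_antiderivative_exists[OF cont] by blast
  have KW: "((\<lambda>x. K * W x) has_real_derivative K * V x) (at x)" for x
    by (intro DERIV_cmult W_deriv)
  have "norm (F y - F x) \<le> K * W y - K * W x" if "x \<le> y" for x y
    using increment_bound[OF F KW le that] .
  moreover have "((\<lambda>x. K * W x) \<longlongrightarrow> K * 0) at_bot"
    by (intro tendsto_intros W_at_bot)
  ultimately obtain L where L: "(F \<longlongrightarrow> L) at_bot"
    using convergent_if_increment_bound[of F "\<lambda>x. K * W x" "K * 0" at_bot] by auto
  show ?thesis
  proof (intro exI[of _ "\<lambda>x. F x - L"] conjI allI)
    show "((\<lambda>x. F x - L) has_vector_derivative f x) (at x)" for x
      using has_vector_derivative_diff[OF F has_vector_derivative_const[of L]] by simp
    show "((\<lambda>x. F x - L) \<longlongrightarrow> 0) at_bot"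
      using tendsto_diff[OF L tendsto_const[of L]] by simp
  qed
qed

text \<open>Picard iteration in the weighted supremum norm \<open>sup \<bar>e\<^sup>-\<^sup>2\<^sup>C\<^sup>W Y\<bar>\<close>, in which the integral operator
  contracts by the factor \<open>1/2\<close> on the whole line at once.\<close>

lemma linear_ode_solution_from_at_bot:
  fixes M :: "real \<Rightarrow> 'a :: euclidean_space \<Rightarrow> 'a" and y0 :: 'a
  assumes lin: "\<And>x. linear (M x)" and bnd: "\<And>x y. norm (M x y) \<le> C * norm y" and "C > 0"
    and cont: "\<And>y. continuous_on UNIV y \<Longrightarrow> continuous_on UNIV (\<lambda>x. M x (y x))"
  obtains Y B where "\<And>x. (Y has_vector_derivative V x *\<^sub>R M x (Y x)) (at x)"
    "(Y \<longlongrightarrow> y0) at_bot" "\<And>x. norm (Y x) \<le> B"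
proof -
  \<comment> \<open>The factor 2 produces the contraction constant: \<open>C * V * E\<close> is half
    the derivative of \<open>E\<close>, so integrating it from -infinity gives
    \<open>(E - 1) / 2\<close>.\<close>
  define K where "K = 2 * C"
  define E where "E = (\<lambda>x. exp (K * W x))"
  \<comment> \<open>The unknown is the rescaled function \<open>Z = Y / E\<close>, so the weighted
    norm of \<open>Y\<close> is the ordinary supremum norm of \<open>Z\<close>, and Banach's theorem
    applies in the complete space of bounded continuous functions.\<close>
  define rhs :: "(real \<Rightarrow>\<^sub>C 'a) \<Rightarrow> real \<Rightarrow> 'a"
    where "rhs Z x = V x *\<^sub>R M x (E x *\<^sub>R apply_bcontfun Z x)" for Z x
  have "K > 0" using \<open>C > 0\<close> by (simp add: K_def)
  have E_ge1: "E x \<ge> 1" for x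
    using \<open>K > 0\<close> W_nonneg[of x] by (simp add: E_def)
  have E_le: "E x \<le> exp (K * I)" for x
    using \<open>K > 0\<close> W_le[of x] by (simp add: E_def)
  have E_cont [continuous_intros]: "continuous_on UNIV E"
    unfolding E_def by (intro continuous_intros)
  have G_deriv: "((\<lambda>x. c * (E x - 1)) has_real_derivative c * (K * V x * E x)) (at x)" for c x
    unfolding E_def by (auto intro!: derivative_eq_intros W_deriv)
  have "((\<lambda>x. c * (E x - 1)) \<longlongrightarrow> c * (exp (K * 0) - 1)) at_bot" for c
    unfolding E_def by (intro tendsto_intros W_at_bot)
  then have G_lim: "((\<lambda>x. c * (E x - 1)) \<longlongrightarrow> 0) at_bot" for c by simp
  have rhs_cont: "continuous_on UNIV (rhs Z)" for Z
    unfolding rhs_def by (intro continuous_intros V_continuous cont) auto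
  have rhs_diff: "rhs Z1 x - rhs Z2 x = rhs (Z1 - Z2) x" for Z1 Z2 x
    by (simp add: rhs_def linear_diff[OF lin] scaleR_diff_right)
  have rhs_bound: "norm (rhs Z x) \<le> (norm Z / 2) * (K * V x * E x)" for Z x
  proof -
    have "norm (rhs Z x) = V x * norm (M x (E x *\<^sub>R Z x))"
      using V_nonneg by (simp add: rhs_def)
    also have "\<dots> \<le> V x * (C * norm (E x *\<^sub>R Z x))"
      by (intro mult_left_mono bnd V_nonneg)
    also have "\<dots> = V x * (C * (E x * norm (Z x)))"
      using E_ge1[of x] by simp
    also have "\<dots> \<le> V x * (C * (E x * norm Z))"
      using E_ge1[of x] \<open>C > 0\<close> V_nonneg by (intro mult_left_mono norm_bounded) auto
    finally show ?thesis by (simp add: K_def mult_ac)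
  qed
  have "\<exists>F. (\<forall>x. (F has_vector_derivative rhs Z x) (at x)) \<and> (F \<longlongrightarrow> 0) at_bot" for Z
  proof (rule antiderivative_vanishing_at_bot[OF rhs_cont])
    fix x
    have "(norm Z / 2) * (K * V x * E x) \<le> (norm Z / 2) * (K * V x * exp (K * I))"
      using \<open>K > 0\<close> V_nonneg E_le by (intro mult_left_mono) auto
    then show "norm (rhs Z x) \<le> (norm Z / 2 * K * exp (K * I)) * V x"
      using rhs_bound[of Z x] by (simp add: mult_ac)
  qed
  then obtain J where J_deriv: "\<And>Z x. (J Z has_vector_derivative rhs Z x) (at x)"
    and J_lim: "\<And>Z. (J Z \<longlongrightarrow> 0) at_bot"
    by metis
  have J_bound: "norm (J Z x) \<le> norm Z / 2 * (E x - 1)" for Z x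
    by (rule norm_le_if_vanishing_at_bot[OF J_deriv J_lim G_deriv G_lim rhs_bound])
  have J_diff_bound: "norm (J Z1 x - J Z2 x) \<le> norm (Z1 - Z2) / 2 * (E x - 1)" for Z1 Z2 x
  proof (rule norm_le_if_vanishing_at_bot[OF _ _ G_deriv G_lim rhs_bound])
    show "((\<lambda>x. J Z1 x - J Z2 x) has_vector_derivative rhs (Z1 - Z2) x) (at x)" for x
      unfolding rhs_diff[symmetric] by (intro has_vector_derivative_diff J_deriv)
    show "((\<lambda>x. J Z1 x - J Z2 x) \<longlongrightarrow> 0) at_bot"
      using tendsto_diff[OF J_lim J_lim] by simp
  qed
  \<comment> \<open>The Picard map in terms of \<open>Z\<close>, with value \<open>y0\<close>
    prescribed at -infinity. \<open>Bcontfun\<close> can be undone only on bounded continuous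
    functions, which is what \<open>T_apply\<close> has to check.\<close>
  define T where "T Z = Bcontfun (\<lambda>x. (1 / E x) *\<^sub>R (y0 + J Z x))" for Z
  have J_cont: "continuous_on UNIV (J Z)" for Z
    using J_deriv has_vector_derivative_continuous continuous_at_imp_continuous_on by blast
  have T_apply: "apply_bcontfun (T Z) x = (1 / E x) *\<^sub>R (y0 + J Z x)" for Z x
  proof -
    have "(\<lambda>x. (1 / E x) *\<^sub>R (y0 + J Z x)) \<in> bcontfun"
    proof (rule bcontfun_normI)
      show "continuous_on UNIV (\<lambda>x. (1 / E x) *\<^sub>R (y0 + J Z x))"
        using E_ge1 by (intro continuous_intros J_cont) (metis not_one_le_zero)
      fix x
      have "norm ((1 / E x) *\<^sub>R (y0 + J Z x)) = norm (y0 + J Z x) / E x"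
        using E_ge1[of x] by simp
      also have "\<dots> \<le> norm (y0 + J Z x)"
        using E_ge1[of x] by (simp add: divide_le_eq mult_left_le_one_le mult_le_cancel_left1)
      also have "\<dots> \<le> norm y0 + norm Z / 2 * (E x - 1)"
        using norm_triangle_ineq J_bound by (smt (verit))
      also have "\<dots> \<le> norm y0 + norm Z / 2 * (exp (K * I) - 1)"
        using E_le by (intro add_mono mult_left_mono) auto
      finally show "norm ((1 / E x) *\<^sub>R (y0 + J Z x)) \<le> norm y0 + norm Z / 2 * (exp (K * I) - 1)" .
    qed
    then show ?thesis by (simp add: T_def Bcontfun_inverse)
  qed
  have "\<exists>!Z. T Z = Z"
  proof (rule banach_fix_type)
    show "\<forall>Z1 Z2. dist (T Z1) (T Z2) \<le> 1 / 2 * dist Z1 Z2"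
      unfolding dist_norm
    proof (intro allI norm_bound)
      fix Z1 Z2 :: "real \<Rightarrow>\<^sub>C 'a" and x
      have "norm (apply_bcontfun (T Z1 - T Z2) x) = norm (J Z1 x - J Z2 x) / E x"
        using E_ge1[of x] by (simp add: T_apply flip: scaleR_diff_right)
      also have "\<dots> \<le> norm (Z1 - Z2) / 2 * (E x - 1) / E x"
        using E_ge1[of x] by (intro divide_right_mono J_diff_bound) auto
      also have "\<dots> \<le> norm (Z1 - Z2) / 2"
        using E_ge1[of x] by (simp add: field_simps)
      finally show "norm (apply_bcontfun (T Z1 - T Z2) x) \<le> 1 / 2 * norm (Z1 - Z2)" by simp
    qed
  qed auto
  then obtain Z where Z: "T Z = Z" by blast
  define Y where "Y x = y0 + J Z x" for x
  have YZ: "E x *\<^sub>R apply_bcontfun Z x = Y x" for x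
    using T_apply[of Z x] E_ge1[of x] by (simp add: Z Y_def)
  show ?thesis
  proof (rule that)
    show "(Y has_vector_derivative V x *\<^sub>R M x (Y x)) (at x)" for x
      using has_vector_derivative_add[OF has_vector_derivative_const[of y0] J_deriv[of Z x]]
      by (simp add: rhs_def YZ flip: Y_def)
    show "(Y \<longlongrightarrow> y0) at_bot"
      using tendsto_add[OF tendsto_const[of y0] J_lim[of Z]] by (simp add: Y_def[abs_def])
    show "norm (Y x) \<le> exp (K * I) * norm Z" for x
      using E_ge1[of x] E_le[of x] norm_bounded[of Z x]
      by (simp flip: YZ) (intro mult_mono; simp)
  qed
qed

end

section \<open>Uniqueness of the scattering coefficient\<close>

lemma norm_square_has_real_derivative:
  fixes f :: "real \<Rightarrow> 'a :: real_inner"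
  assumes "(f has_vector_derivative f') (at x)"
  shows "((\<lambda>x. (norm (f x))\<^sup>2) has_real_derivative 2 * (f x \<bullet> f')) (at x)"
proof -
  have "((\<lambda>x. f x \<bullet> f x) has_derivative (\<lambda>h. f x \<bullet> (h *\<^sub>R f') + (h *\<^sub>R f') \<bullet> f x)) (at x)"
    using assms unfolding has_vector_derivative_def by (intro has_derivative_inner)
  moreover have "(\<lambda>h. f x \<bullet> (h *\<^sub>R f') + (h *\<^sub>R f') \<bullet> f x) = (*) (2 * (f x \<bullet> f'))"
    by (auto simp: inner_commute)
  ultimately show ?thesis
    by (simp add: has_field_derivative_def power2_norm_eq_inner)
qed

text \<open>A periodic function with limit 0 is identically 0: sampling along a fixed phase plus
  whole periods gives a constant sequence. The phases 0 and pi/2 then yield the sum and the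
  difference of the coefficients.\<close>

lemma cis_combination_vanishing:
  fixes \<omega> :: real
  assumes "((\<lambda>x. \<alpha> * cis (\<omega> * x) + \<beta> * cis (- (\<omega> * x))) \<longlongrightarrow> 0) at_top" and "\<omega> > 0"
  shows "\<alpha> = 0 \<and> \<beta> = 0"
proof -
  define f where "f x = \<alpha> * cis (\<omega> * x) + \<beta> * cis (- (\<omega> * x))" for x
  have at_phase: "\<alpha> * cis t + \<beta> * cis (- t) = 0" for t
  proof -
    have "filterlim (\<lambda>n. t / \<omega> + (2 * pi / \<omega>) * real n) at_top sequentially"
      using \<open>\<omega> > 0\<close> by (intro filterlim_tendsto_add_at_top[OF tendsto_const] filterlim_tendsto_pos_mult_at_top[OF tendsto_const]
          filterlim_real_sequentially) auto
    then have "(\<lambda>n. f (t / \<omega> + (2 * pi / \<omega>) * real n)) \<longlonglongrightarrow> 0"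
      using assms(1) filterlim_compose unfolding f_def by blast
    moreover have "f (t / \<omega> + (2 * pi / \<omega>) * real n) = \<alpha> * cis t + \<beta> * cis (- t)" for n
    proof -
      have "\<omega> * (t / \<omega> + (2 * pi / \<omega>) * real n) = 2 * pi * real n + t"
        using \<open>\<omega> > 0\<close> by (simp add: field_simps)
      moreover have "cis (2 * pi * real n + t) = cis t"
        by (simp flip: cis_mult)
      ultimately show ?thesis
        unfolding f_def cis_cnj[symmetric] by (simp only:)
    qed
    ultimately show ?thesis by (simp add: LIMSEQ_const_iff)
  qed
  have "\<alpha> + \<beta> = 0" using at_phase[of 0] by simp
  moreover have "\<i> * (\<alpha> - \<beta>) = 0"
    using at_phase[of "pi / 2"] by (simp add: algebra_simps flip: cis_cnj)
  ultimately show ?thesis by auto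
qed

lemma wave_solution_diff:
  assumes "wave_solution V \<omega> \<psi>" "wave_solution V \<omega> \<phi>"
  shows "wave_solution V \<omega> (\<lambda>x. \<psi> x - \<phi> x)"
proof -
  obtain \<psi>' \<psi>'' \<phi>' \<phi>'' where *:
    "\<And>x. (\<psi> has_vector_derivative \<psi>' x) (at x)" "\<And>x. (\<psi>' has_vector_derivative \<psi>'' x) (at x)"
    "\<And>x. \<psi>'' x + of_real (\<omega> ^ 2 - V x) * \<psi> x = 0"
    "\<And>x. (\<phi> has_vector_derivative \<phi>' x) (at x)" "\<And>x. (\<phi>' has_vector_derivative \<phi>'' x) (at x)"
    "\<And>x. \<phi>'' x + of_real (\<omega> ^ 2 - V x) * \<phi> x = 0"
    using assms unfolding wave_solution_def by metis
  have "\<psi>'' x - \<phi>'' x + of_real (\<omega> ^ 2 - V x) * (\<psi> x - \<phi> x) = 0" for x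
  proof -
    have "(\<psi>'' x + of_real (\<omega> ^ 2 - V x) * \<psi> x) - (\<phi>'' x + of_real (\<omega> ^ 2 - V x) * \<phi> x) = 0"
      by (simp only: * diff_self)
    then show ?thesis by (simp add: algebra_simps)
  qed
  then show ?thesis
    unfolding wave_solution_def using * has_vector_derivative_diff
    by (intro exI[of _ "\<lambda>x. \<psi>' x - \<phi>' x"] exI[of _ "\<lambda>x. \<psi>'' x - \<phi>'' x"]) blast
qed

context integrable_potential begin

text \<open>The energy \<open>E\<close>, built from \<open>\<phi>'\<close> and
  \<open>\<omega> * \<phi>\<close>, has derivative at most \<open>E * V / \<omega>\<close>, so
  \<open>E * exp (- W / \<omega>)\<close> is nonincreasing. Its limit at -infinity is 0, which
  forces \<open>E\<close> to vanish. The hypothesis controls only \<open>\<phi>\<close>, so the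
  decay of \<open>\<phi>'\<close> is derived first.\<close>

lemma wave_solution_vanishing_at_bot:
  assumes sol: "wave_solution V \<omega> \<phi>" and lim: "(\<phi> \<longlongrightarrow> 0) at_bot" and "\<omega> > 0"
  shows "\<phi> x = 0"
proof -
  obtain \<phi>' \<phi>'' where \<phi>: "\<And>x. (\<phi> has_vector_derivative \<phi>' x) (at x)"
    and \<phi>': "\<And>x. (\<phi>' has_vector_derivative \<phi>'' x) (at x)"
    and "\<And>x. \<phi>'' x + of_real (\<omega> ^ 2 - V x) * \<phi> x = 0"
    using sol unfolding wave_solution_def by metis
  then have eq: "\<phi>'' x = (V x - \<omega>\<^sup>2) *\<^sub>R \<phi> x" for x
    by (simp add: scaleR_conv_of_real algebra_simps eq_neg_iff_add_eq_0)
  define D where "D = 2 + I + \<omega>\<^sup>2"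
  have "I \<ge> 0" using W_nonneg[of 0] W_le[of 0] by linarith
  then have "D > 0" by (simp add: D_def add_pos_nonneg)
  \<comment> \<open>A Landau-type inequality on a unit interval: \<open>\<phi>'\<close> varies there
    by at most \<open>\<delta> * (I + \<omega>\<^sup>2)\<close>, and the increment of
    \<open>\<phi>\<close> is at most \<open>2 * \<delta>\<close>; together these give
    \<open>D\<close>. Only the integral of \<open>V\<close> enters, so no pointwise bound on
    \<open>V\<close> is required.\<close>
  have landau: "norm (\<phi>' x) \<le> \<delta> * D" if small: "\<And>t. t \<le> x + 1 \<Longrightarrow> norm (\<phi> t) \<le> \<delta>" for x \<delta>
  proof -
    have "\<delta> \<ge> 0" using small[of x] norm_ge_zero[of "\<phi> x"] by linarith
    have \<phi>'_var: "norm (\<phi>' y - \<phi>' x) \<le> \<delta> * (I + \<omega>\<^sup>2)" if "x \<le> y" "y \<le> x + 1" for y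
    proof -
      have "norm (\<phi>' y - \<phi>' x) \<le> \<delta> * (W y + \<omega>\<^sup>2 * y) - \<delta> * (W x + \<omega>\<^sup>2 * x)"
      proof (rule increment_bound[OF \<phi>'])
        show "((\<lambda>x. \<delta> * (W x + \<omega>\<^sup>2 * x)) has_real_derivative \<delta> * (V x + \<omega>\<^sup>2)) (at x)" for x
          by (auto intro!: derivative_eq_intros W_deriv)
        show "norm (\<phi>'' t) \<le> \<delta> * (V t + \<omega>\<^sup>2)" if "t < y" for t
        proof -
          have "\<bar>V t - \<omega>\<^sup>2\<bar> \<le> V t + \<omega>\<^sup>2" using V_nonneg[of t] by (simp add: abs_le_iff)
          moreover have "norm (\<phi> t) \<le> \<delta>" using small \<open>t < y\<close> \<open>y \<le> x + 1\<close> by simp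
          ultimately have "\<bar>V t - \<omega>\<^sup>2\<bar> * norm (\<phi> t) \<le> (V t + \<omega>\<^sup>2) * \<delta>"
            by (intro mult_mono) auto
          then show ?thesis by (simp add: eq mult.commute)
        qed
      qed fact
      also have "\<dots> = \<delta> * (W y - W x + \<omega>\<^sup>2 * (y - x))" by (simp add: algebra_simps)
      also have "\<dots> \<le> \<delta> * (I + \<omega>\<^sup>2 * 1)"
        using that W_nonneg[of x] W_le[of y] \<open>\<delta> \<ge> 0\<close>
        by (intro mult_left_mono add_mono) auto
      finally show ?thesis by simp
    qed
    \<comment> \<open>Subtracting the linear function with slope \<open>\<phi>' x\<close> leaves the
      derivative \<open>\<phi>' t - \<phi>' x\<close>, which was just bounded.\<close>
    have "norm ((\<phi> (x + 1) - (x + 1) *\<^sub>R \<phi>' x) - (\<phi> x - x *\<^sub>R \<phi>' x))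
            \<le> (\<delta> * (I + \<omega>\<^sup>2)) * (x + 1) - (\<delta> * (I + \<omega>\<^sup>2)) * x"
    proof (rule increment_bound)
      show "((\<lambda>t. \<phi> t - t *\<^sub>R \<phi>' x) has_vector_derivative \<phi>' t - \<phi>' x) (at t)" for t
        by (auto intro!: derivative_eq_intros \<phi>)
      show "((\<lambda>t. (\<delta> * (I + \<omega>\<^sup>2)) * t) has_real_derivative \<delta> * (I + \<omega>\<^sup>2)) (at t)" for t
        by (auto intro!: derivative_eq_intros)
    qed (use \<phi>'_var in auto)
    then have "norm (\<phi> (x + 1) - \<phi> x - \<phi>' x) \<le> \<delta> * (I + \<omega>\<^sup>2)"
      by (simp add: algebra_simps)
    moreover have "norm (\<phi>' x) \<le> norm (\<phi> (x + 1) - \<phi> x - \<phi>' x) + (norm (\<phi> (x + 1)) + norm (\<phi> x))"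
      using norm_triangle_ineq4[of "\<phi> (x + 1) - \<phi> x" "\<phi> (x + 1) - \<phi> x - \<phi>' x"]
        norm_triangle_ineq4[of "\<phi> (x + 1)" "\<phi> x"] by simp
    ultimately show ?thesis
      using small[of x] small[of "x + 1"] by (simp add: D_def algebra_simps)
  qed
  have lim': "(\<phi>' \<longlongrightarrow> 0) at_bot"
  proof (rule tendstoI)
    fix e :: real assume "e > 0"
    then have "e / (2 * D) > 0" using \<open>D > 0\<close> by simp
    then obtain N where N: "\<And>t. t \<le> N \<Longrightarrow> norm (\<phi> t) < e / (2 * D)"
      using tendstoD[OF lim] unfolding eventually_at_bot_linorder dist_norm by auto
    have "norm (\<phi>' x) < e" if "x \<le> N - 1" for x
    proof -
      have "norm (\<phi>' x) \<le> e / (2 * D) * D"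
        using N that by (intro landau less_imp_le) auto
      then show ?thesis using \<open>D > 0\<close> \<open>e > 0\<close> by simp
    qed
    then show "eventually (\<lambda>x. dist (\<phi>' x) 0 < e) at_bot"
      unfolding eventually_at_bot_linorder by auto
  qed
  define E where "E x = (norm (\<phi>' x))\<^sup>2 + \<omega>\<^sup>2 * (norm (\<phi> x))\<^sup>2" for x
  have E_deriv: "(E has_real_derivative 2 * V x * (\<phi>' x \<bullet> \<phi> x)) (at x)" for x
    unfolding E_def
    by (rule derivative_eq_intros norm_square_has_real_derivative \<phi> \<phi>' refl)+
       (simp add: eq inner_commute algebra_simps)
  have E_deriv_le: "2 * V x * (\<phi>' x \<bullet> \<phi> x) \<le> E x * (V x / \<omega>)" for x
  proof -
    \<comment> \<open>Cauchy-Schwarz, followed by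
      \<open>2 * u * v \<le> u\<^sup>2 + v\<^sup>2\<close> with \<open>v\<close> the norm of
      \<open>\<omega> * \<phi>\<close>.\<close>
    have "2 * \<omega> * (\<phi>' x \<bullet> \<phi> x) \<le> 2 * \<omega> * (norm (\<phi>' x) * norm (\<phi> x))"
      using \<open>\<omega> > 0\<close> norm_cauchy_schwarz by (intro mult_left_mono) auto
    also have "\<dots> \<le> E x"
      using sum_squares_bound[of "norm (\<phi>' x)" "\<omega> * norm (\<phi> x)"]
      by (simp add: E_def power_mult_distrib mult_ac)
    finally have "2 * \<omega> * (\<phi>' x \<bullet> \<phi> x) * (V x / \<omega>) \<le> E x * (V x / \<omega>)"
      using V_nonneg \<open>\<omega> > 0\<close> by (intro mult_right_mono) auto
    then show ?thesis using \<open>\<omega> > 0\<close> by (simp add: mult_ac)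
  qed
  define H where "H x = E x * exp (- W x / \<omega>)" for x
  have "H y \<le> H x" if "x \<le> y" for x y
    using that
  proof (rule DERIV_nonpos_imp_nonincreasing, intro exI conjI)
    fix t
    show "(H has_real_derivative
            (2 * V t * (\<phi>' t \<bullet> \<phi> t) - E t * (V t / \<omega>)) * exp (- W t / \<omega>)) (at t)"
    proof -
      have "((\<lambda>x. exp (- W x / \<omega>)) has_real_derivative exp (- W t / \<omega>) * (- V t / \<omega>)) (at t)"
        using \<open>\<omega> > 0\<close> by (auto intro!: derivative_eq_intros W_deriv)
      from DERIV_mult[OF E_deriv this] show ?thesis
        unfolding H_def by (simp add: algebra_simps)
    qed
    show "(2 * V t * (\<phi>' t \<bullet> \<phi> t) - E t * (V t / \<omega>)) * exp (- W t / \<omega>) \<le> 0"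
      using E_deriv_le[of t] by (simp add: mult_nonpos_nonneg)
  qed
  then have "eventually (\<lambda>t. H x \<le> H t) at_bot"
    unfolding eventually_at_bot_linorder by blast
  moreover have "(H \<longlongrightarrow> (norm (0::complex))\<^sup>2 * exp (- 0 / \<omega>) + \<omega>\<^sup>2 * (norm (0::complex))\<^sup>2 * exp (- 0 / \<omega>)) at_bot"
    unfolding H_def E_def distrib_right using \<open>\<omega> > 0\<close> by (intro tendsto_intros lim lim' W_at_bot) auto
  ultimately have "H x \<le> 0"
    using tendsto_lowerbound[of H 0 at_bot "H x"] by simp
  then have "E x \<le> 0" by (simp add: H_def mult_le_0_iff)
  moreover have "\<omega>\<^sup>2 * (norm (\<phi> x))\<^sup>2 \<le> E x" by (simp add: E_def)
  ultimately have "\<omega>\<^sup>2 * (norm (\<phi> x))\<^sup>2 \<le> 0" by linarith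
  then show ?thesis using \<open>\<omega> > 0\<close> by (simp add: mult_le_0_iff)
qed

text \<open>Two scattering solutions differ by a solution vanishing at -infinity, so they coincide;
  comparing the two expansions of the same function at +infinity then identifies the
  coefficients.\<close>

lemma scattering_coefficient_unique:
  assumes "scattering_solution V \<omega> \<psi>\<^sub>1 \<alpha>\<^sub>1 \<beta>\<^sub>1" "scattering_solution V \<omega> \<psi>\<^sub>2 \<alpha>\<^sub>2 \<beta>\<^sub>2" "\<omega> > 0"
  shows "\<alpha>\<^sub>1 = \<alpha>\<^sub>2"
proof -
  have "((\<lambda>x. (\<psi>\<^sub>1 x - exp (\<i> * of_real (\<omega> * x))) - (\<psi>\<^sub>2 x - exp (\<i> * of_real (\<omega> * x)))) \<longlongrightarrow> 0 - 0) at_bot"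
    using assms unfolding scattering_solution_def by (intro tendsto_diff) auto
  then have "((\<lambda>x. \<psi>\<^sub>1 x - \<psi>\<^sub>2 x) \<longlongrightarrow> 0) at_bot" by simp
  moreover have "wave_solution V \<omega> (\<lambda>x. \<psi>\<^sub>1 x - \<psi>\<^sub>2 x)"
    using assms by (auto simp: scattering_solution_def intro: wave_solution_diff)
  ultimately have "\<psi>\<^sub>1 x - \<psi>\<^sub>2 x = 0" for x
    using wave_solution_vanishing_at_bot \<open>\<omega> > 0\<close> by blast
  then have eq: "\<psi>\<^sub>1 = \<psi>\<^sub>2" by auto
  have cis: "exp (- \<i> * of_real (\<omega> * x)) = cis (- (\<omega> * x))"
    "exp (\<i> * of_real (\<omega> * x)) = cis (\<omega> * x)" for x
    by (simp_all add: cis_conv_exp)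
  have "((\<lambda>x. (\<psi>\<^sub>1 x - (\<alpha>\<^sub>2 * cis (\<omega> * x) + \<beta>\<^sub>2 * cis (- (\<omega> * x))))
            - (\<psi>\<^sub>1 x - (\<alpha>\<^sub>1 * cis (\<omega> * x) + \<beta>\<^sub>1 * cis (- (\<omega> * x))))) \<longlongrightarrow> 0 - 0) at_top"
    using assms(1,2) unfolding scattering_solution_def cis eq by (intro tendsto_diff) auto
  then have "((\<lambda>x. (\<alpha>\<^sub>1 - \<alpha>\<^sub>2) * cis (\<omega> * x) + (\<beta>\<^sub>1 - \<beta>\<^sub>2) * cis (- (\<omega> * x))) \<longlongrightarrow> 0) at_top"
    by (simp add: algebra_simps)
  then show ?thesis
    using cis_combination_vanishing \<open>\<omega> > 0\<close> by fastforce
qed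

section \<open>Growth estimate for the amplitudes\<close>

text \<open>Formally \<open>arcosh u\<close> has derivative
  \<open>u' / sqrt (u\<^sup>2 - 1)\<close>, at most \<open>\<kappa> * V\<close>, and grows from 0.
  This quotient is singular where \<open>u = 1\<close>, the very value approached at -infinity.
  Adding \<open>\<epsilon>\<close> under the root gives a smooth substitute with derivative
  \<open>u' / sqrt (u\<^sup>2 - 1 + \<epsilon>)\<close>; the bound survives as
  \<open>\<epsilon>\<close> tends to 0 from the right.\<close>

lemma cosh_growth_bound:
  fixes u u' :: "real \<Rightarrow> real" and \<kappa> U :: real
  assumes u_deriv: "\<And>x. (u has_real_derivative u' x) (at x)" and u_ge1: "\<And>x. u x \<ge> 1"
    and u'_le: "\<And>x. u' x \<le> \<kappa> * V x * sqrt ((u x)\<^sup>2 - 1)"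
    and u_bot: "(u \<longlongrightarrow> 1) at_bot" and u_top: "(u \<longlongrightarrow> U) at_top" and "\<kappa> > 0"
  shows "U \<le> cosh (\<kappa> * I)"
proof -
  have "I \<ge> 0" using W_nonneg[of 0] W_le[of 0] by linarith
  have "U \<ge> 1" using u_ge1 by (intro tendsto_lowerbound[OF u_top]) auto
  have regularized: "ln (U + sqrt (U\<^sup>2 - 1 + \<epsilon>)) \<le> ln (1 + sqrt \<epsilon>) + \<kappa> * I" if "\<epsilon> > 0" for \<epsilon>
  proof -
    define R where "R v = sqrt (v\<^sup>2 - 1 + \<epsilon>)" for v :: real
    define L where "L x = ln (u x + R (u x)) - \<kappa> * W x" for x
    have pos: "v\<^sup>2 - 1 + \<epsilon> > 0" if "v \<ge> 1" for v :: real
      using one_le_power[OF that, of 2] \<open>\<epsilon> > 0\<close> by simp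
    have R_pos: "R v > 0" if "v \<ge> 1" for v
      using pos[OF that] by (simp add: R_def)
    have L_deriv: "(L has_real_derivative u' x / R (u x) - \<kappa> * V x) (at x)" for x
    proof -
      have "((\<lambda>x. (u x)\<^sup>2 - 1 + \<epsilon>) has_real_derivative 2 * u x * u' x) (at x)"
        by (rule derivative_eq_intros u_deriv refl)+ simp
      from DERIV_chain2[OF DERIV_real_sqrt[OF pos[OF u_ge1]] this]
      have "((\<lambda>x. R (u x)) has_real_derivative u x * u' x / R (u x)) (at x)"
        by (simp add: R_def field_simps)
      then have "((\<lambda>x. u x + R (u x)) has_real_derivative u' x + u x * u' x / R (u x)) (at x)"
        by (intro DERIV_add u_deriv)
      moreover have "u x + R (u x) > 0"
        using R_pos[OF u_ge1[of x]] u_ge1[of x] by linarith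
      ultimately have "((\<lambda>x. ln (u x + R (u x))) has_real_derivative
          (1 / (u x + R (u x))) * (u' x + u x * u' x / R (u x))) (at x)"
        by (intro DERIV_chain2[OF DERIV_ln_divide]) auto
      moreover have "(1 / (u x + R (u x))) * (u' x + u x * u' x / R (u x)) = u' x / R (u x)"
        using R_pos[OF u_ge1[of x]] \<open>u x + R (u x) > 0\<close> by (simp add: divide_simps) (simp add: algebra_simps)
      ultimately have "((\<lambda>x. ln (u x + R (u x))) has_real_derivative u' x / R (u x)) (at x)"
        by (simp only:)
      then show ?thesis
        unfolding L_def by (intro DERIV_diff DERIV_cmult W_deriv)
    qed
    have L_deriv_le: "u' x / R (u x) - \<kappa> * V x \<le> 0" for x
    proof -
      have "u' x \<le> \<kappa> * V x * sqrt ((u x)\<^sup>2 - 1)" by (rule u'_le)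
      also have "\<dots> \<le> \<kappa> * V x * R (u x)"
        using \<open>\<kappa> > 0\<close> V_nonneg \<open>\<epsilon> > 0\<close> by (intro mult_left_mono) (auto simp: R_def)
      finally show ?thesis using R_pos[OF u_ge1[of x]] by (simp add: divide_le_eq)
    qed
    have L_antimono: "L y \<le> L x" if "x \<le> y" for x y
      using that
      by (rule DERIV_nonpos_imp_nonincreasing) (use L_deriv L_deriv_le in blast)
    have L_lim: "(L \<longlongrightarrow> ln (v + R v) - \<kappa> * w) F"
      if "(u \<longlongrightarrow> v) F" "(W \<longlongrightarrow> w) F" "v \<ge> 1" for v w F
    proof -
      have "v + R v \<noteq> 0" using R_pos[OF \<open>v \<ge> 1\<close>] \<open>v \<ge> 1\<close> by linarith
      then show ?thesis
        unfolding L_def R_def using that by (intro tendsto_intros)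
    qed
    \<comment> \<open>The value at 0 links the two ends: the nonincreasing \<open>L\<close> lies
      below its limit at -infinity and above its limit at +infinity.\<close>
    have "L 0 \<le> ln (1 + R 1) - \<kappa> * 0"
      by (rule tendsto_lowerbound[OF L_lim[OF u_bot W_at_bot]])
         (auto intro: eventually_mono[OF eventually_le_at_bot[of 0]] L_antimono)
    moreover have "ln (U + R U) - \<kappa> * I \<le> L 0"
      by (rule tendsto_upperbound[OF L_lim[OF u_top W_at_top \<open>U \<ge> 1\<close>]])
         (auto intro: eventually_mono[OF eventually_ge_at_top[of 0]] L_antimono)
    ultimately show ?thesis by (simp add: R_def)
  qed
  have "((\<lambda>\<epsilon>. ln (U + sqrt (U\<^sup>2 - 1 + \<epsilon>))) \<longlongrightarrow> ln (U + sqrt (U\<^sup>2 - 1 + 0))) (at_right 0)"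
    using \<open>U \<ge> 1\<close> by (intro tendsto_intros) (auto intro!: add_pos_nonneg simp: add_nonneg_eq_0_iff)
  moreover have "((\<lambda>\<epsilon>. ln (1 + sqrt \<epsilon>) + \<kappa> * I) \<longlongrightarrow> ln (1 + sqrt 0) + \<kappa> * I) (at_right 0)"
    by (intro tendsto_intros) auto
  moreover have "eventually (\<lambda>\<epsilon>. ln (U + sqrt (U\<^sup>2 - 1 + \<epsilon>)) \<le> ln (1 + sqrt \<epsilon>) + \<kappa> * I) (at_right 0)"
    using eventually_at_right_less[of 0] by eventually_elim (rule regularized)
  ultimately have "ln (U + sqrt (U\<^sup>2 - 1 + 0)) \<le> ln (1 + sqrt 0) + \<kappa> * I"
    by (intro tendsto_le[of "at_right 0"]) auto
  then have "arcosh U \<le> \<kappa> * I" using \<open>U \<ge> 1\<close> by (simp add: arcosh_real_def)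
  then have "cosh (arcosh U) \<le> cosh (\<kappa> * I)"
    using \<open>U \<ge> 1\<close> \<open>\<kappa> > 0\<close> \<open>I \<ge> 0\<close> by (subst cosh_real_nonneg_le_iff) auto
  then show ?thesis using \<open>U \<ge> 1\<close> by simp
qed

section \<open>Existence of the scattering solution\<close>

text \<open>Variation of constants \<open>\<psi> = a e\<^sup>i\<^sup>\<omega>\<^sup>x + b e\<^sup>-\<^sup>i\<^sup>\<omega>\<^sup>x\<close> with
  \<open>\<psi>' = i\<omega> (a e\<^sup>i\<^sup>\<omega>\<^sup>x - b e\<^sup>-\<^sup>i\<^sup>\<omega>\<^sup>x)\<close>; the amplitudes inherit the factor \<open>V\<close> in their derivatives,
  hence converge at both ends.\<close>

lemma scattering_amplitudes_exist:
  fixes \<omega> :: real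
  assumes "\<omega> > 0"
  defines "k \<equiv> - \<i> / of_real (2 * \<omega>)"
  obtains a b \<alpha> \<beta> where
    "\<And>x. (a has_vector_derivative V x *\<^sub>R (k * (a x + b x * cis (- (2 * \<omega> * x))))) (at x)"
    "\<And>x. (b has_vector_derivative V x *\<^sub>R (- k * (b x + a x * cis (2 * \<omega> * x)))) (at x)"
    "(a \<longlongrightarrow> 1) at_bot" "(b \<longlongrightarrow> 0) at_bot" "(a \<longlongrightarrow> \<alpha>) at_top" "(b \<longlongrightarrow> \<beta>) at_top"
proof -
  define M :: "real \<Rightarrow> complex \<times> complex \<Rightarrow> complex \<times> complex" where
    "M x y = (k * (fst y + snd y * cis (- (2 * \<omega> * x))), - k * (snd y + fst y * cis (2 * \<omega> * x)))" for x y
  \<comment> \<open>Each component of \<open>M x y\<close> has norm at most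
    \<open>norm y / \<omega>\<close>, and the norm of a pair is at most the sum of the norms of its
    components.\<close>
  define C where "C = 2 / \<omega>"
  have "C > 0" using \<open>\<omega> > 0\<close> by (simp add: C_def)
  have norm_k: "norm k = 1 / (2 * \<omega>)"
    using \<open>\<omega> > 0\<close> by (simp add: k_def norm_divide norm_mult)
  have M_linear: "linear (M x)" for x
    by (rule linearI) (auto simp: M_def algebra_simps)
  have M_bound: "norm (M x y) \<le> C * norm y" for x y
  proof -
    have "norm (k * (v + w * cis t)) \<le> (1 / (2 * \<omega>)) * (2 * norm y)"
      if "norm v \<le> norm y" "norm w \<le> norm y" for v w t
      unfolding norm_mult norm_k using \<open>\<omega> > 0\<close> that norm_triangle_ineq[of v "w * cis t"]
      by (intro mult_left_mono) (auto simp: norm_mult)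
    then have "norm (fst (M x y)) \<le> norm y / \<omega>" "norm (snd (M x y)) \<le> norm y / \<omega>"
      using norm_fst_le[of "fst y" "snd y"] norm_snd_le[of "snd y" "fst y"] by (auto simp: M_def simp del: mult_minus_left)
    then show ?thesis
      using norm_Pair_le[of "fst (M x y)" "snd (M x y)"] by (simp add: C_def)
  qed
  have M_cont: "continuous_on UNIV (\<lambda>x. M x (y x))" if "continuous_on UNIV y" for y
    unfolding M_def using that by (intro continuous_intros)
  obtain Y B where Y_deriv: "\<And>x. (Y has_vector_derivative V x *\<^sub>R M x (Y x)) (at x)"
    and Y_bot: "(Y \<longlongrightarrow> (1, 0)) at_bot" and Y_bound: "\<And>x. norm (Y x) \<le> B"
    using linear_ode_solution_from_at_bot[OF M_linear M_bound \<open>C > 0\<close> M_cont] by metis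
  have CBW: "((\<lambda>x. C * B * W x) has_real_derivative C * B * V x) (at x)" for x
    by (intro DERIV_cmult W_deriv)
  \<comment> \<open>Since \<open>Y\<close> is bounded, its derivative is dominated by a multiple of
    \<open>V\<close>; this yields the limit at +infinity.\<close>
  have "norm (V x *\<^sub>R M x (Y x)) \<le> C * B * V x" for x
  proof -
    have "norm (M x (Y x)) \<le> C * B"
      using M_bound[of x "Y x"] mult_left_mono[OF Y_bound[of x], of C] \<open>C > 0\<close> by linarith
    from mult_left_mono[OF this V_nonneg[of x]] show ?thesis
      using V_nonneg[of x] by (simp add: mult_ac)
  qed
  then have "norm (Y y - Y x) \<le> C * B * W y - C * B * W x" if "x \<le> y" for x y
    using increment_bound[OF Y_deriv CBW _ that] by blast
  then obtain L where Y_top: "(Y \<longlongrightarrow> L) at_top"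
    using convergent_if_increment_bound[of Y "\<lambda>x. C * B * W x"] tendsto_mult_left[OF W_at_top]
      trivial_limit_at_top_linorder by blast
  show ?thesis
  proof (rule that)
    show "((\<lambda>x. fst (Y x)) has_vector_derivative
        V x *\<^sub>R (k * (fst (Y x) + snd (Y x) * cis (- (2 * \<omega> * x))))) (at x)" for x
      using bounded_linear.has_vector_derivative[OF bounded_linear_fst Y_deriv[of x]]
      by (simp add: M_def)
    show "((\<lambda>x. snd (Y x)) has_vector_derivative
        V x *\<^sub>R (- k * (snd (Y x) + fst (Y x) * cis (2 * \<omega> * x)))) (at x)" for x
      using bounded_linear.has_vector_derivative[OF bounded_linear_snd Y_deriv[of x]]
      by (simp add: M_def)
  qed (use tendsto_fst[OF Y_bot] tendsto_snd[OF Y_bot] tendsto_fst[OF Y_top] tendsto_snd[OF Y_top] in auto)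
qed

text \<open>The terms from differentiating \<open>a\<close> and \<open>b\<close> are
  \<open>V * k * \<psi>\<close> and its negative. They cancel in the first derivative of
  \<open>\<psi>\<close> and reinforce each other in the second, where they contribute
  \<open>2 * \<i> * \<omega> * k * V * \<psi>\<close>; the value of \<open>k\<close> makes this
  exactly \<open>V * \<psi>\<close>.\<close>

lemma scattering_solution_from_amplitudes:
  fixes \<omega> :: real
  assumes "\<omega> > 0"
  defines "k \<equiv> - \<i> / of_real (2 * \<omega>)"
  assumes a: "\<And>x. (a has_vector_derivative V x *\<^sub>R (k * (a x + b x * cis (- (2 * \<omega> * x))))) (at x)"
    and b: "\<And>x. (b has_vector_derivative V x *\<^sub>R (- k * (b x + a x * cis (2 * \<omega> * x)))) (at x)"
    and bot: "(a \<longlongrightarrow> 1) at_bot" "(b \<longlongrightarrow> 0) at_bot"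
    and top: "(a \<longlongrightarrow> \<alpha>) at_top" "(b \<longlongrightarrow> \<beta>) at_top"
  shows "scattering_solution V \<omega> (\<lambda>x. a x * cis (\<omega> * x) + b x * cis (- (\<omega> * x))) \<alpha> \<beta>"
proof -
  define \<psi> where "\<psi> x = a x * cis (\<omega> * x) + b x * cis (- (\<omega> * x))" for x
  define \<psi>' where "\<psi>' x = \<i> * of_real \<omega> * (a x * cis (\<omega> * x) - b x * cis (- (\<omega> * x)))" for x
  have e: "((\<lambda>x. cis (\<omega> * x)) has_vector_derivative of_real \<omega> * (\<i> * cis (\<omega> * x))) (at x)"
    "((\<lambda>x. cis (- (\<omega> * x))) has_vector_derivative - of_real \<omega> * (\<i> * cis (- (\<omega> * x)))) (at x)" for x
    unfolding has_vector_derivative_def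
    by (auto intro!: derivative_eq_intros simp: scaleR_conv_of_real)
  have phase: "cis (- (2 * \<omega> * x)) * cis (\<omega> * x) = cis (- (\<omega> * x))"
    "cis (2 * \<omega> * x) * cis (- (\<omega> * x)) = cis (\<omega> * x)" for x
    by (simp_all add: cis_mult algebra_simps)
  have a'e: "(V x *\<^sub>R (k * (a x + b x * cis (- (2 * \<omega> * x))))) * cis (\<omega> * x) = V x *\<^sub>R (k * \<psi> x)" for x
    using phase(1)[of x] by (simp add: \<psi>_def algebra_simps)
  have b'e: "(V x *\<^sub>R (- k * (b x + a x * cis (2 * \<omega> * x)))) * cis (- (\<omega> * x)) = - (V x *\<^sub>R (k * \<psi> x))" for x
    using phase(2)[of x] by (simp add: \<psi>_def algebra_simps)
  have ae: "((\<lambda>x. a x * cis (\<omega> * x)) has_vector_derivative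
      a x * (of_real \<omega> * (\<i> * cis (\<omega> * x))) + V x *\<^sub>R (k * \<psi> x)) (at x)" for x
    using has_vector_derivative_mult[OF a e(1)] unfolding a'e .
  have be: "((\<lambda>x. b x * cis (- (\<omega> * x))) has_vector_derivative
      b x * (- of_real \<omega> * (\<i> * cis (- (\<omega> * x)))) - V x *\<^sub>R (k * \<psi> x)) (at x)" for x
    using has_vector_derivative_mult[OF b e(2)] unfolding b'e by simp
  have "(\<psi> has_vector_derivative \<psi>' x) (at x)" for x
    unfolding \<psi>_def[abs_def] \<psi>'_def
    by (rule has_vector_derivative_eq_rhs[OF has_vector_derivative_add[OF ae be]])
       (simp add: algebra_simps)
  moreover have "(\<psi>' has_vector_derivative - of_real (\<omega>\<^sup>2 - V x) * \<psi> x) (at x)" for x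
  proof -
    have "\<i> * (of_real \<omega> * (2 * k)) = 1" using \<open>\<omega> > 0\<close> by (simp add: k_def field_simps)
    then have "\<i> * of_real \<omega> * (2 * (V x *\<^sub>R (k * \<psi> x))) = V x *\<^sub>R \<psi> x"
      by (simp add: scaleR_conv_of_real)
    then show ?thesis
      unfolding \<psi>'_def[abs_def]
      by (intro has_vector_derivative_eq_rhs[OF has_vector_derivative_mult_right
            [OF has_vector_derivative_diff[OF ae be]]])
         (simp add: scaleR_conv_of_real \<psi>_def algebra_simps power2_eq_square)
  qed
  ultimately have "wave_solution V \<omega> \<psi>"
    unfolding wave_solution_def
    by - (rule exI[of _ \<psi>'], rule exI[of _ "\<lambda>x. - of_real (\<omega>\<^sup>2 - V x) * \<psi> x"], auto simp: algebra_simps)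
  \<comment> \<open>Stated for any filter because it gives the asymptotics at both ends: the phases
    have modulus 1, so the error is controlled by the amplitude errors.\<close>
  moreover have "((\<lambda>x. \<psi> x - (A * cis (\<omega> * x) + B * cis (- (\<omega> * x)))) \<longlongrightarrow> 0) F"
    if "(a \<longlongrightarrow> A) F" "(b \<longlongrightarrow> B) F" for A B F
  proof (rule Lim_null_comparison)
    show "((\<lambda>x. norm (a x - A) + norm (b x - B)) \<longlongrightarrow> 0) F"
      using tendsto_add[OF that[THEN LIM_zero, THEN tendsto_norm_zero]] by simp
    have "\<psi> x - (A * cis (\<omega> * x) + B * cis (- (\<omega> * x)))
        = (a x - A) * cis (\<omega> * x) + (b x - B) * cis (- (\<omega> * x))" for x
      by (simp add: \<psi>_def algebra_simps)
    then have "norm (\<psi> x - (A * cis (\<omega> * x) + B * cis (- (\<omega> * x)))) \<le> norm (a x - A) + norm (b x - B)" for x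
      using norm_triangle_ineq[of "(a x - A) * cis (\<omega> * x)" "(b x - B) * cis (- (\<omega> * x))"]
      by (simp add: norm_mult)
    then show "eventually (\<lambda>x. norm (\<psi> x - (A * cis (\<omega> * x) + B * cis (- (\<omega> * x))))
        \<le> norm (a x - A) + norm (b x - B)) F"
      by simp
  qed
  from this[OF bot] this[OF top]
  have "((\<lambda>x. \<psi> x - cis (\<omega> * x)) \<longlongrightarrow> 0) at_bot"
    "((\<lambda>x. \<psi> x - (\<alpha> * cis (\<omega> * x) + \<beta> * cis (- (\<omega> * x)))) \<longlongrightarrow> 0) at_top" by simp_all
  ultimately show ?thesis
    unfolding scattering_solution_def \<psi>_def[symmetric] by (simp add: cis_conv_exp)
qed

section \<open>Bounds for the transmission amplitude\<close>

text \<open>Because \<open>k\<close> is purely imaginary, the squared moduli of \<open>a\<close> and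
  \<open>b\<close> have the same derivative, which gives the conservation law. The growth bound then
  applies to their sum, and \<open>cosh (2 * y) = 2 * (cosh y)\<^sup>2 - 1\<close> converts it into
  a bound on \<open>\<alpha>\<close>. The lower bound 1 ensures that dividing by the squared modulus
  of \<open>\<alpha>\<close> is legitimate.\<close>

lemma transmission_amplitude_bounds:
  fixes \<omega> :: real
  assumes "\<omega> > 0"
  defines "k \<equiv> - \<i> / of_real (2 * \<omega>)"
  assumes a: "\<And>x. (a has_vector_derivative V x *\<^sub>R (k * (a x + b x * cis (- (2 * \<omega> * x))))) (at x)"
    and b: "\<And>x. (b has_vector_derivative V x *\<^sub>R (- k * (b x + a x * cis (2 * \<omega> * x)))) (at x)"
    and bot: "(a \<longlongrightarrow> 1) at_bot" "(b \<longlongrightarrow> 0) at_bot" and top: "(a \<longlongrightarrow> \<alpha>) at_top"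
  shows "1 \<le> (norm \<alpha>)\<^sup>2" and "(norm \<alpha>)\<^sup>2 \<le> (cosh (I / (2 * \<omega>)))\<^sup>2"
proof -
  define p where "p x = (norm (a x))\<^sup>2" for x
  define q where "q x = (norm (b x))\<^sup>2" for x
  define d where "d x = 2 * (a x \<bullet> (V x *\<^sub>R (k * (a x + b x * cis (- (2 * \<omega> * x))))))" for x
  have k_Re: "Re k = 0" by (simp add: k_def Re_divide)
  have d_eq: "d x = 2 * (a x \<bullet> (V x *\<^sub>R (k * (b x * cis (- (2 * \<omega> * x))))))" for x
    by (simp add: d_def k_Re inner_complex_def algebra_simps)
  \<comment> \<open>The diagonal term drops out as before, and the mixed terms agree because
    \<open>- k\<close> is the complex conjugate of \<open>k\<close>.\<close>
  have d_eq_q: "d x = 2 * (b x \<bullet> (V x *\<^sub>R (- k * (b x + a x * cis (2 * \<omega> * x)))))" for x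
    by (simp add: d_def k_Re inner_complex_def algebra_simps)
  have p_deriv: "(p has_real_derivative d x) (at x)" for x
    unfolding p_def[abs_def] d_def by (rule norm_square_has_real_derivative[OF a])
  have q_deriv: "(q has_real_derivative d x) (at x)" for x
    unfolding q_def[abs_def] d_eq_q by (rule norm_square_has_real_derivative[OF b])
  have p_bot: "(p \<longlongrightarrow> 1) at_bot"
    unfolding p_def[abs_def] using tendsto_power[OF tendsto_norm[OF bot(1)], of 2] by simp
  have q_bot: "(q \<longlongrightarrow> 0) at_bot"
    unfolding q_def[abs_def] using tendsto_power[OF tendsto_norm[OF bot(2)], of 2] by simp
  have pq: "p x - q x = 1" for x
  proof -
    have "((\<lambda>x. p x - q x) has_real_derivative 0) (at x)" for x
      using DERIV_diff[OF p_deriv q_deriv] by simp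
    then have "p y - q y = p 0 - q 0" for y
      by (rule DERIV_isconst_all[rule_format])
    then obtain c where c: "p y - q y = c" for y by blast
    have "((\<lambda>y :: real. c) \<longlongrightarrow> 1 - 0) at_bot"
      using tendsto_diff[OF p_bot q_bot] by (simp only: c)
    then show ?thesis by (simp add: c tendsto_const_iff)
  qed
  have q_nonneg: "q x \<ge> 0" for x by (simp add: q_def)
  \<comment> \<open>By \<open>pq\<close> this is \<open>p + q\<close>; written through
    \<open>p\<close> alone, its limit at +infinity involves only \<open>\<alpha>\<close>.\<close>
  define u where "u x = 2 * p x - 1" for x
  have u_bound: "2 * d x \<le> (1 / \<omega>) * V x * sqrt ((u x)\<^sup>2 - 1)" for x
  proof -
    have "d x \<le> 2 * (norm (a x) * norm (V x *\<^sub>R (k * (b x * cis (- (2 * \<omega> * x))))))"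
      unfolding d_eq by (intro mult_left_mono norm_cauchy_schwarz) auto
    also have "\<dots> = (1 / \<omega>) * V x * (norm (a x) * norm (b x))"
      using \<open>\<omega> > 0\<close> V_nonneg[of x] by (simp add: k_def norm_mult norm_divide)
    finally have "2 * d x \<le> (1 / \<omega>) * V x * (2 * (norm (a x) * norm (b x)))"
      using \<open>\<omega> > 0\<close> by (simp add: field_simps)
    also have "2 * (norm (a x) * norm (b x)) = sqrt ((u x)\<^sup>2 - 1)"
    proof (rule real_sqrt_unique[symmetric])
      have "p x = 1 + q x" using pq[of x] by simp
      then have "(u x)\<^sup>2 - 1 = 4 * p x * q x"
        by (simp add: u_def power2_eq_square algebra_simps)
      then show "(2 * (norm (a x) * norm (b x)))\<^sup>2 = (u x)\<^sup>2 - 1"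
        by (simp add: p_def q_def power_mult_distrib)
    qed simp
    finally show ?thesis .
  qed
  have p_top: "(p \<longlongrightarrow> (norm \<alpha>)\<^sup>2) at_top"
    unfolding p_def[abs_def] by (intro tendsto_intros top)
  have p_ge1: "p x \<ge> 1" for x using pq[of x] q_nonneg[of x] by linarith
  show "1 \<le> (norm \<alpha>)\<^sup>2"
    using p_ge1 by (intro tendsto_lowerbound[OF p_top]) auto
  have "2 * (norm \<alpha>)\<^sup>2 - 1 \<le> cosh ((1 / \<omega>) * I)"
  proof (rule cosh_growth_bound[OF _ _ u_bound])
    show "(u has_real_derivative 2 * d x) (at x)" for x
      unfolding u_def[abs_def] by (auto intro!: derivative_eq_intros p_deriv)
    show "u x \<ge> 1" for x using p_ge1[of x] by (simp add: u_def)
    have "(u \<longlongrightarrow> 2 * 1 - 1) at_bot"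
      unfolding u_def[abs_def] by (intro tendsto_intros p_bot)
    then show "(u \<longlongrightarrow> 1) at_bot" by simp
    show "(u \<longlongrightarrow> 2 * (norm \<alpha>)\<^sup>2 - 1) at_top"
      unfolding u_def[abs_def] by (intro tendsto_intros p_top)
    show "1 / \<omega> > 0" using \<open>\<omega> > 0\<close> by simp
  qed
  also have "(1 / \<omega>) * I = 2 * (I / (2 * \<omega>))" by simp
  finally show "(norm \<alpha>)\<^sup>2 \<le> (cosh (I / (2 * \<omega>)))\<^sup>2"
    unfolding cosh_double_cosh by simp
qed

theorem transmission_probability_ge_sech:
  assumes "\<omega> > 0"
  shows "transmission_probability V \<omega> \<ge> (sech (I / (2 * \<omega>)))\<^sup>2"
proof -
  obtain a b \<alpha> \<beta> where amp:
    "\<And>x. (a has_vector_derivative V x *\<^sub>R (- \<i> / of_real (2 * \<omega>) * (a x + b x * cis (- (2 * \<omega> * x))))) (at x)"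
    "\<And>x. (b has_vector_derivative V x *\<^sub>R (- (- \<i> / of_real (2 * \<omega>)) * (b x + a x * cis (2 * \<omega> * x)))) (at x)"
    "(a \<longlongrightarrow> 1) at_bot" "(b \<longlongrightarrow> 0) at_bot" "(a \<longlongrightarrow> \<alpha>) at_top" "(b \<longlongrightarrow> \<beta>) at_top"
    using scattering_amplitudes_exist[OF assms] by blast
  obtain \<psi> where sol: "scattering_solution V \<omega> \<psi> \<alpha> \<beta>"
    using scattering_solution_from_amplitudes[OF assms amp] by blast
  have "transmission_probability V \<omega> = 1 / (norm \<alpha>)\<^sup>2"
    unfolding transmission_probability_def
    using sol scattering_coefficient_unique[OF _ sol assms] by (intro the_equality) blast+
  moreover have "1 / (cosh (I / (2 * \<omega>)))\<^sup>2 \<le> 1 / (norm \<alpha>)\<^sup>2"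
    using transmission_amplitude_bounds[OF assms amp(1-5)]
    by (intro divide_left_mono) (auto intro!: mult_pos_pos)
  ultimately show ?thesis by (simp add: sech_def power_divide)
qed

end

section \<open>The tortoise coordinate and its inverse\<close>

context
  fixes m :: real
  assumes m_pos: "m > 0"
begin

lemma tortoise_has_real_derivative:
  assumes "r > 2 * m"
  shows "(tortoise m has_real_derivative inverse (1 - 2 * m / r)) (at r)"
proof -
  have "r > 0" using assms m_pos by linarith
  have "((\<lambda>r. r + 2 * m * ln ((r - 2 * m) / (2 * m))) has_real_derivative
      1 + 2 * m * (1 / ((r - 2 * m) / (2 * m)) * (1 / (2 * m)))) (at r)"
    using assms m_pos by (auto intro!: derivative_eq_intros)
  also have "1 + 2 * m * (1 / ((r - 2 * m) / (2 * m)) * (1 / (2 * m))) = inverse (1 - 2 * m / r)"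
    using assms m_pos \<open>r > 0\<close> by (simp add: field_simps)
  finally show ?thesis by (simp add: tortoise_def[abs_def])
qed

lemma tortoise_strict_mono: "strict_mono_on {2 * m<..} (tortoise m)"
  using m_pos by (auto intro!: strict_mono_onI add_strict_mono simp: tortoise_def divide_strict_right_mono)

lemma tortoise_surj:
  "\<exists>r > 2 * m. tortoise m r = x"
proof -
  \<comment> \<open>For \<open>r1\<close> the logarithm equals \<open>- t\<close>, so
    \<open>tortoise m r1 = r1 - 2 * m * t\<close>. Taking \<open>t\<close> nonnegative gives
    \<open>r1 \<le> 4 * m\<close>, and the other entry of the maximum then pushes the value down to
    at most \<open>x\<close>.\<close>
  define t where "t = max 0 ((4 * m - x) / (2 * m))"
  define r1 where "r1 = 2 * m + 2 * m * exp (- t)"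
  have "r1 > 2 * m" using m_pos by (simp add: r1_def)
  have "2 * m * ((4 * m - x) / (2 * m)) \<le> 2 * m * t"
    using m_pos by (intro mult_left_mono) (auto simp: t_def)
  then have "4 * m - x \<le> 2 * m * t" using m_pos by simp
  moreover have "tortoise m r1 = r1 - 2 * m * t"
    using m_pos by (simp add: tortoise_def r1_def)
  moreover have "r1 \<le> 4 * m"
    using m_pos mult_left_mono[of "exp (- t)" 1 "2 * m"] by (simp add: r1_def t_def)
  ultimately have r1: "tortoise m r1 \<le> x" by linarith
  \<comment> \<open>From \<open>4 * m\<close> on the argument of the logarithm is at least 1, so the
    tortoise coordinate is at least \<open>r2\<close>, hence at least \<open>x\<close>.\<close>
  define r2 where "r2 = max (max x r1) (4 * m)"
  have "tortoise m r2 \<ge> r2"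
    using m_pos by (auto simp: tortoise_def r2_def field_simps)
  then have "tortoise m r2 \<ge> x" "r1 \<le> r2" by (auto simp: r2_def)
  have "\<exists>r\<ge>r1. r \<le> r2 \<and> tortoise m r = x"
  proof (rule IVT)
    show "\<forall>r. r1 \<le> r \<and> r \<le> r2 \<longrightarrow> isCont (tortoise m) r"
      using \<open>r1 > 2 * m\<close> tortoise_has_real_derivative DERIV_isCont by (meson less_le_trans)
  qed fact+
  then show ?thesis using \<open>r1 > 2 * m\<close> less_le_trans by blast
qed

lemma tortoise_bij_betw: "bij_betw (tortoise m) {2 * m<..} UNIV"
  unfolding bij_betw_def
proof
  show "inj_on (tortoise m) {2 * m<..}"
    by (rule strict_mono_on_imp_inj_on[OF tortoise_strict_mono])
  show "tortoise m ` {2 * m<..} = UNIV"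
    using tortoise_surj by (auto simp: image_iff) (metis greaterThan_iff)
qed

lemma radius_gt: "radius m x > 2 * m"
  using the_inv_into_into[OF bij_betw_imp_inj_on[OF tortoise_bij_betw], of x "{2 * m<..}"]
    bij_betw_imp_surj_on[OF tortoise_bij_betw] by (simp add: radius_def)

lemma tortoise_radius: "tortoise m (radius m x) = x"
  unfolding radius_def using tortoise_bij_betw by (intro f_the_inv_into_f_bij_betw) auto

lemma radius_tortoise: "r > 2 * m \<Longrightarrow> radius m (tortoise m r) = r"
  unfolding radius_def using bij_betw_imp_inj_on[OF tortoise_bij_betw] by (intro the_inv_into_f_f) auto

lemma radius_less_iff: "r > 2 * m \<Longrightarrow> radius m x < r \<longleftrightarrow> x < tortoise m r"
  using strict_mono_on_less[OF tortoise_strict_mono, of "radius m x" r] radius_gt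
  by (simp add: tortoise_radius)

lemma radius_isCont: "isCont (radius m) x"
proof -
  define r where "r = radius m x"
  have "r > 2 * m" unfolding r_def by (rule radius_gt)
  have "isCont (radius m) (tortoise m r)"
  proof (rule isCont_inverse_function2[where f = "tortoise m"])
    \<comment> \<open>The midpoint between the horizon and \<open>r\<close> as left end keeps the
      whole interval inside the domain of bijectivity.\<close>
    show "(2 * m + r) / 2 < r" "r < r + 1" using \<open>r > 2 * m\<close> by auto
    fix z assume "(2 * m + r) / 2 \<le> z"
    then have "z > 2 * m" using \<open>r > 2 * m\<close> by simp
    then show "radius m (tortoise m z) = z" "isCont (tortoise m) z"
      using radius_tortoise tortoise_has_real_derivative DERIV_isCont by blast+
  qed
  then show ?thesis by (simp add: r_def tortoise_radius)
qed

lemma radius_has_real_derivative: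
  "(radius m has_real_derivative 1 - 2 * m / radius m x) (at x)"
proof -
  have "2 * m / radius m x < 1" using radius_gt[of x] m_pos by (simp add: divide_less_eq)
  then have "(radius m has_real_derivative inverse (inverse (1 - 2 * m / radius m x))) (at x)"
    using DERIV_inverse_function[where f = "tortoise m" and g = "radius m" and a = "x - 1" and b = "x + 1",
        OF tortoise_has_real_derivative[OF radius_gt[of x]] _ _ _ tortoise_radius radius_isCont]
      radius_gt[of x]
    by simp
  then show ?thesis by simp
qed

lemma radius_at_bot: "(radius m \<longlongrightarrow> 2 * m) at_bot"
proof (rule order_tendstoI)
  fix y assume "y < 2 * m"
  then show "eventually (\<lambda>x. y < radius m x) at_bot"
    using radius_gt by (intro always_eventually) (meson less_trans)
next
  fix y assume "y > 2 * m"
  then show "eventually (\<lambda>x. radius m x < y) at_bot"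
    using eventually_gt_at_bot[of "tortoise m y"] by (simp add: radius_less_iff)
qed

lemma radius_at_top: "filterlim (radius m) at_top at_top"
  unfolding filterlim_at_top_dense
proof
  fix y
  \<comment> \<open>The maximum with \<open>3 * m\<close> puts the threshold outside the horizon,
    where \<open>radius_less_iff\<close> is available; \<open>r + 1\<close> makes the final
    inequality strict.\<close>
  define r where "r = max y (3 * m)"
  have "r > 2 * m" using m_pos by (simp add: r_def)
  have "eventually (\<lambda>x. x > tortoise m (r + 1)) at_top" by (rule eventually_gt_at_top)
  then show "eventually (\<lambda>x. y < radius m x) at_top"
  proof eventually_elim
    case (elim x)
    then have "\<not> radius m x < r + 1" using \<open>r > 2 * m\<close> by (simp add: radius_less_iff)
    then show ?case by (simp add: r_def)
  qed
qed

section \<open>The Regge-Wheeler potential and the final bound\<close>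

text \<open>Changing variables to \<open>r\<close> cancels the factor \<open>1 - 2 * m / r\<close>,
  leaving inverse square and inverse cube terms to integrate. The constant in the antiderivative is
  fixed by its value at the horizon \<open>r = 2 * m\<close>, so it vanishes at -infinity; as
  \<open>r\<close> grows only the constant survives, and this is the total integral.\<close>

lemma regge_wheeler_integrable_potential:
  fixes s l :: nat
  assumes "l \<ge> s"
  shows "integrable_potential (\<lambda>x. regge_wheeler_potential m s l (radius m x))
    (\<lambda>x. (2 * real l * (real l + 1) + (1 - (real s)\<^sup>2)) / (4 * m)
       - (real l * (real l + 1) / radius m x + m * (1 - (real s)\<^sup>2) / (radius m x)\<^sup>2))
    ((2 * real l * (real l + 1) + (1 - (real s)\<^sup>2)) / (4 * m))"
    (is "integrable_potential ?V ?W ?I")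
proof
  have r: "radius m x > 2 * m" "radius m x > 0" for x
    using radius_gt[of x] m_pos by auto
  have "isCont ?V x" for x
    unfolding regge_wheeler_potential_def using r(2)[of x]
    by (intro continuous_intros radius_isCont) auto
  then show "continuous_on UNIV ?V" by (simp add: continuous_on_eq_continuous_at)
  show "?V x \<ge> 0" for x
  proof -
    define \<rho> where "\<rho> = radius m x"
    have \<rho>: "\<rho> > 0" "2 * m / \<rho> \<le> 1" "2 * m / \<rho> \<ge> 0"
      using r[of x] m_pos by (auto simp: \<rho>_def)
    \<comment> \<open>For \<open>s > 1\<close> the second term of the potential is negative. It is
      absorbed by the first, since \<open>s\<^sup>2 - 1\<close> is at most
      \<open>l * (l + 1)\<close> and \<open>2 * m / \<rho>\<close> is at most 1.\<close>
    have "(real s)\<^sup>2 \<le> real l * real l"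
      using assms by (simp add: power2_eq_square mult_mono)
    then have "(2 * m / \<rho>) * ((real s)\<^sup>2 - 1) \<le> (2 * m / \<rho>) * (real l * (real l + 1))"
      using \<rho> by (intro mult_left_mono) (auto simp: algebra_simps)
    also have "\<dots> \<le> real l * (real l + 1)"
      using \<rho> by (intro mult_left_le_one_le) auto
    finally have "0 \<le> (1 - 2 * m / \<rho>) * ((real l * (real l + 1) + (2 * m / \<rho>) * (1 - (real s)\<^sup>2)) / \<rho>\<^sup>2)"
      using \<rho> by (intro mult_nonneg_nonneg divide_nonneg_nonneg) (auto simp: algebra_simps)
    also have "\<dots> = ?V x"
      using \<rho>(1) by (simp add: regge_wheeler_potential_def add_divide_distrib power2_eq_square power3_eq_cube flip: \<rho>_def)
    finally show ?thesis .
  qed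
  show "(?W has_real_derivative ?V x) (at x)" for x
  proof -
    define A where "A = real l * (real l + 1)"
    define B where "B = m * (1 - (real s)\<^sup>2)"
    have B2: "2 * B = 2 * m * (1 - (real s)\<^sup>2)" by (simp only: B_def mult.assoc)
    have "((\<lambda>y. ?I - (A / y + B / y\<^sup>2)) has_real_derivative A / y\<^sup>2 + 2 * B / y ^ 3) (at y)"
      if "y > 0" for y :: real
      using that by (auto intro!: derivative_eq_intros simp: power2_eq_square power3_eq_cube)
        (simp add: field_simps)
    from DERIV_chain2[OF this[OF r(2)[of x]] radius_has_real_derivative[of x]]
    have "((\<lambda>x. ?I - (A / radius m x + B / (radius m x)\<^sup>2)) has_real_derivative
        (A / (radius m x)\<^sup>2 + 2 * B / radius m x ^ 3) * (1 - 2 * m / radius m x)) (at x)" .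
    moreover have "(A / (radius m x)\<^sup>2 + 2 * B / radius m x ^ 3) * (1 - 2 * m / radius m x) = ?V x"
      unfolding regge_wheeler_potential_def B2 A_def by (rule mult.commute)
    ultimately show ?thesis
      by (simp only: A_def B_def)
  qed
  have "(?W \<longlongrightarrow> ?I - (real l * (real l + 1) / (2 * m) + m * (1 - (real s)\<^sup>2) / (2 * m)\<^sup>2)) at_bot"
    using m_pos by (intro tendsto_intros radius_at_bot) auto
  also have "?I - (real l * (real l + 1) / (2 * m) + m * (1 - (real s)\<^sup>2) / (2 * m)\<^sup>2) = 0"
    using m_pos by (simp add: field_simps power2_eq_square)
  finally show "(?W \<longlongrightarrow> 0) at_bot" .
  have "(?W \<longlongrightarrow> ?I - (0 + 0)) at_top"
    by (intro tendsto_diff tendsto_add tendsto_const real_tendsto_divide_at_top[OF tendsto_const]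
        filterlim_pow_at_top radius_at_top) simp
  then show "(?W \<longlongrightarrow> ?I) at_top" by (simp only: add_0_right diff_zero)
qed

end

theorem mainTheorem4:
  fixes m \<omega> :: real and s l :: nat
  assumes "m > 0" and "\<omega> > 0" and "l \<ge> s"
  shows "greybody_factor m s l \<omega>
           \<ge> (sech ((2 * real l * (real l + 1) + (1 - (real s) ^ 2)) / (8 * \<omega> * m))) ^ 2
       \<and> (sech ((2 * real l * (real l + 1) + (1 - (real s) ^ 2)) / (8 * \<omega> * m))) ^ 2
           = (sech (((real l + 1) ^ 2 + ((real l) ^ 2 - (real s) ^ 2)) / (8 * \<omega> * m))) ^ 2"
proof
  let ?N = "2 * real l * (real l + 1) + (1 - (real s)\<^sup>2)"
  have "(sech (?N / (4 * m) / (2 * \<omega>)))\<^sup>2 \<le> greybody_factor m s l \<omega>"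
    unfolding greybody_factor_def
    using integrable_potential.transmission_probability_ge_sech
      [OF regge_wheeler_integrable_potential[OF \<open>m > 0\<close> \<open>l \<ge> s\<close>] \<open>\<omega> > 0\<close>] .
  moreover have "?N / (4 * m) / (2 * \<omega>) = ?N / (8 * \<omega> * m)" by (simp add: mult_ac)
  ultimately show "(sech (?N / (8 * \<omega> * m)))\<^sup>2 \<le> greybody_factor m s l \<omega>" by (simp only:)
  have "?N = (real l + 1)\<^sup>2 + ((real l)\<^sup>2 - (real s)\<^sup>2)"
    by (simp add: power2_eq_square algebra_simps)
  then show "(sech (?N / (8 * \<omega> * m)))\<^sup>2
      = (sech (((real l + 1)\<^sup>2 + ((real l)\<^sup>2 - (real s)\<^sup>2)) / (8 * \<omega> * m)))\<^sup>2" by (simp only:)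
qed

end
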